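(* The exponential generating functions of the sub-Eulerian polynomials of type $D$ are given, as formal power series in $x$, by (i) $\displaystyle D^{0,\geqslant 2}(x,t)=\frac{t(e^{x(1-t)}-1)^2}{2(1-t)(1-te^{2x(1-t)})}=D^1(x,t)$; (ii) $\displaystyle D^{\geqslant 2}(x,t)=\frac{-1-x(1-t)+e^{x(1-t)}}{(1-t)(1-te^{2x(1-t)})}$; (iii) $\displaystyle D^{0,1}(x,t)=\frac{t^2e^{x(1-t)}-t^2[1-x(1-t)]e^{2x(1-t)}}{(1-t)(1-te^{2x(1-t)})}$.
   Context: $B_n$ is the group of signed permutations $\pi=\pi_1\pi_2\cdots\pi_n$ of $\{1,\dots,n\}$, and $D_n\subset B_n$ is the subgroup (Coxeter group of type $D$) of those with an even number of negative entries. For $n\geqslant 2$, an index $i\in\{0,1,\dots,n-1\}$ is a ($D$-)descent of $\pi$ if $\pi_i>\pi_{i+1}$, where $\pi_0:=-\pi_2$. For $n\geqslant 2$ and an integer $k$, let $D_{n,k}^1$, $D_{n,k}^{0,1}$, $D_{n,k}^{\geqslant 2}$, $D_{n,k}^{0,\geqslant 2}$ be the number of elements of $D_n$ with exactly $k$ descents such that, respectively: $1$ is a descent but $0$ is not; both $0$ and $1$ are descents; neither $0$ nor $1$ is a descent; $0$ is a descent but $1$ is not (sub-Eulerian numbers). For $*\in\{1;\ 0,1;\ \geqslant 2;\ 0,\geqslant 2\}$ the sub-Eulerian polynomials are $D_n^*(t)=\sum_{k\geqslant 0}D_{n,k}^*t^k$, and their exponential generating functions are $D^*(x,t)=\sum_{n\geqslant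 2}D_n^*(t)\frac{x^n}{n!}$. Identities may be read in the ring of formal power series in $x$ with coefficients in $\mathbb{Q}(t)$. *)

theory Defs
  imports
    "HOL-Combinatorics.Permutations"
    "HOL-Computational_Algebra.Computational_Algebra"
begin

text \<open>
  A signed permutation of \<open>{1..n}\<close> is an odd permutation function of \<open>{-n..n}\<close>;
  its one-line notation is \<open>\<pi> 1, \<dots>, \<pi> n\<close>. Oddness forces \<open>\<pi> 0 = 0\<close>, and \<open>permutes\<close> makes
  \<open>\<pi>\<close> the identity outside \<open>{-n..n}\<close>, so that distinct functions are distinct signed permutations.
\<close>
definition signed_perms :: "nat \<Rightarrow> (int \<Rightarrow> int) set" where
  "signed_perms n = {\<pi>. \<pi> permutes {- int n..int n} \<and> (\<forall>i. \<pi> (- i) = - \<pi> i)}"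

definition D_perms :: "nat \<Rightarrow> (int \<Rightarrow> int) set" where
  "D_perms n = {\<pi> \<in> signed_perms n. even (card {i \<in> {1..int n}. \<pi> i < 0})}"

text \<open>The convention \<open>\<pi>\<^sub>0 = - \<pi>\<^sub>2\<close> overrides the function value \<open>\<pi> 0 = 0\<close>.\<close>
definition D_entry :: "(int \<Rightarrow> int) \<Rightarrow> nat \<Rightarrow> int" where
  "D_entry \<pi> i = (if i = 0 then - \<pi> 2 else \<pi> (int i))"

definition D_descents :: "nat \<Rightarrow> (int \<Rightarrow> int) \<Rightarrow> nat set" where
  "D_descents n \<pi> = {i. i < n \<and> D_entry \<pi> i > D_entry \<pi> (i + 1)}"

text \<open>
  The four families of sub-Eulerian numbers are indexed by the set \<open>S\<close> of those elements of
  \<open>{0, 1}\<close> that are descents: \<open>S = {1}\<close>, \<open>{0, 1}\<close>, \<open>{}\<close>, \<open>{0}\<close> stand for the superscripts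
  \<open>1\<close>; \<open>0,1\<close>; \<open>\<ge>2\<close>; \<open>0,\<ge>2\<close>, respectively. Only \<open>n \<ge> 2\<close> is meaningful.
\<close>
definition sub_eulerian :: "nat set \<Rightarrow> nat \<Rightarrow> nat \<Rightarrow> nat" where
  "sub_eulerian S n k =
     card {\<pi> \<in> D_perms n. card (D_descents n \<pi>) = k \<and> D_descents n \<pi> \<inter> {0, 1} = S}"

text \<open>Truncating the sum at \<open>n\<close> loses nothing, see \<open>coeff_sub_eulerian_poly\<close> below.\<close>
definition sub_eulerian_poly :: "nat set \<Rightarrow> nat \<Rightarrow> rat poly" where
  "sub_eulerian_poly S n = (\<Sum>k\<le>n. monom (of_nat (sub_eulerian S n k)) k)"

lemma card_D_descents_le: "card (D_descents n \<pi>) \<le> n"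
proof -
  have "card (D_descents n \<pi>) \<le> card {..<n}"
    by (rule card_mono) (auto simp: D_descents_def)
  then show ?thesis by simp
qed

lemma coeff_sub_eulerian_poly: "coeff (sub_eulerian_poly S n) k = of_nat (sub_eulerian S n k)"
proof (cases "k \<le> n")
  case True
  then show ?thesis by (simp add: sub_eulerian_poly_def coeff_sum)
next
  case False
  then have "{\<pi> \<in> D_perms n. card (D_descents n \<pi>) = k \<and> D_descents n \<pi> \<inter> {0, 1} = S} = {}"
    using card_D_descents_le by fastforce
  then have "sub_eulerian S n k = 0" by (simp only: sub_eulerian_def card.empty)
  with False show ?thesis by (simp add: sub_eulerian_poly_def coeff_sum)
qed

text \<open>Power series in \<open>x\<close> over the field \<open>\<rat>(t)\<close>, represented as \<^typ>\<open>rat poly fract\<close>.\<close>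
definition sub_eulerian_egf :: "nat set \<Rightarrow> rat poly fract fps" where
  "sub_eulerian_egf S =
     Abs_fps (\<lambda>n. if n \<ge> 2 then to_fract (sub_eulerian_poly S n) / of_nat (fact n) else 0)"

end

theory Submission
  imports Defs
begin

text \<open>
  Write \<open>y = x (1 - t)\<close> and \<open>E\<close> for the exponential series. All four formulas have the shape
  \<open>t^|S| F(y) / (2 (1 - t) (1 - t E(2 y)))\<close>, where \<open>S \<subseteq> {0, 1}\<close> is the prescribed set of initial
  descents and \<open>F\<close> is the exponential generating function of the signed words that increase from
  their second letter on and have initial descents \<open>S\<close>.

  The factor \<open>1/2\<close> replaces type \<open>D\<close> by type \<open>B\<close>. Changing the sign of the letter \<open>\<plusminus>1\<close> affects no
  comparison between letters, since that letter has the smallest absolute value, but it changes the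
  parity of the number of negative letters. So the descent sets on \<open>D_n\<close> and on its complement in
  \<open>B_n\<close> have the same distribution (\<open>sum_signed_perms_eq_double_sum_D_perms\<close>).

  The shape of the generating function comes from cutting off increasing suffixes. For a fixed
  word, a telescoping sum over all its increasing suffixes recovers \<open>t^des\<close>
  (\<open>power_des_eq_sum_sorted_suffix\<close>). Summing over all words, an increasing suffix on a given set
  of \<open>m\<close> absolute values amounts to a choice of signs, in \<open>2^m\<close> ways, so the sums over words
  satisfy a binomial recurrence (\<open>tail_des_sum_rec\<close>), which says that their generating function
  times \<open>1 - t E(2 y)\<close> is known (\<open>tail_des_sum_eq_fps_nth\<close>).

  It remains to count words of length \<open>m \<ge> 2\<close> with increasing tail by initial descents
  (\<open>card_sorted_tail_words\<close>). There are \<open>2^m\<close> fully increasing words. Only two of them, the positive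
  one and the one with its smallest letter negated, have no initial descent, and the other
  \<open>2^m - 2\<close> have initial descents \<open>{0}\<close>. Negating the first letter exchanges \<open>{0}\<close> and \<open>{1}\<close>. Since
  \<open>m 2^m\<close> words have an increasing tail, \<open>m 2^m - 2 (2^m) + 2\<close> remain for \<open>{0, 1}\<close>.
\<close>

section \<open>Descents of words\<close>

fun des :: "'a::linorder list \<Rightarrow> nat" where
  "des [] = 0"
| "des [x] = 0"
| "des (x # y # zs) = of_bool (x > y) + des (y # zs)"

lemma des_eq_card: "des xs = card {j. Suc j < length xs \<and> xs ! j > xs ! Suc j}"
proof (induction xs rule: des.induct)
  case (3 x y zs)
  let ?D = "\<lambda>xs. {j. Suc j < length xs \<and> xs ! j > xs ! Suc j}"
  have fin: "finite (?D (y # zs))"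
    by (rule finite_subset[of _ "{..<length (y # zs)}"]) auto
  have "?D (x # y # zs) = (if x > y then {0} else {}) \<union> Suc ` ?D (y # zs)"
  proof (rule set_eqI)
    fix j show "j \<in> ?D (x # y # zs) \<longleftrightarrow> j \<in> (if x > y then {0} else {}) \<union> Suc ` ?D (y # zs)"
      by (cases j) (auto simp: image_iff)
  qed
  moreover have "card ((if x > y then {0} else {}) \<union> Suc ` ?D (y # zs))
      = of_bool (x > y) + card (?D (y # zs))"
    using fin by (subst card_Un_disjoint) (auto simp: card_image)
  ultimately show ?case
    using 3 by simp
qed auto

text \<open>Let \<open>p\<close> be the position of the last descent. Cutting at \<open>p\<close> loses this descent, and cutting
  after \<open>p\<close> loses none, so the terms are \<open>t^des\<close> times a geometric progression in \<open>1 - t\<close> that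
  telescopes. If there is no descent, the progression stops short of the cut before the first
  letter, and the separate summand makes up for it.\<close>

lemma power_des_eq_sum_sorted_suffix:
  fixes t :: "'a::comm_ring_1" and ys :: "'b::linorder list"
  shows "t ^ des ys = of_bool (sorted ys) * (1 - t) ^ length ys
    + (\<Sum>k=1..length ys. of_bool (sorted (drop k ys)) * t ^ Suc (des (take k ys)) * (1 - t) ^ (length ys - k))"
proof (induction ys rule: des.induct)
  case (3 x y zs)
  let ?ys = "y # zs"
  let ?S = "\<Sum>k=1..length ?ys. of_bool (sorted (drop k ?ys)) * t ^ Suc (des (take k ?ys)) * (1 - t) ^ (length ?ys - k)"
  have take: "des (x # take k ?ys) = of_bool (x > y) + des (take k ?ys)" if "k \<in> {1..length ?ys}" for k
    using that by (cases k) auto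
  have "(\<Sum>k=1..length (x # ?ys). of_bool (sorted (drop k (x # ?ys))) * t ^ Suc (des (take k (x # ?ys))) * (1 - t) ^ (length (x # ?ys) - k))
      = of_bool (sorted ?ys) * t * (1 - t) ^ length ?ys
        + (\<Sum>k=1..length ?ys. of_bool (sorted (drop k ?ys)) * t ^ Suc (des (x # take k ?ys)) * (1 - t) ^ (length ?ys - k))"
    unfolding length_Cons[of x] One_nat_def
    by (subst sum.atLeast_Suc_atMost) (simp_all only: sum.atLeast_Suc_atMost_Suc_shift, simp_all)
  also have "(\<Sum>k=1..length ?ys. of_bool (sorted (drop k ?ys)) * t ^ Suc (des (x # take k ?ys)) * (1 - t) ^ (length ?ys - k))
      = t ^ of_bool (x > y) * ?S"
    unfolding sum_distrib_left by (intro sum.cong refl) (simp only: take, simp add: power_add mult_ac)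
  finally have rec: "(\<Sum>k=1..length (x # ?ys). of_bool (sorted (drop k (x # ?ys))) * t ^ Suc (des (take k (x # ?ys))) * (1 - t) ^ (length (x # ?ys) - k))
      = of_bool (sorted ?ys) * t * (1 - t) ^ length ?ys + t ^ of_bool (x > y) * ?S" .
  have "t ^ des (x # ?ys) = t ^ of_bool (x > y) * t ^ des ?ys"
    by (simp add: power_add)
  also have "\<dots> = t ^ of_bool (x > y) * (of_bool (sorted ?ys) * (1 - t) ^ length ?ys + ?S)"
    by (simp only: 3)
  also have "\<dots> = of_bool (sorted (x # ?ys)) * (1 - t) ^ length (x # ?ys)
      + (of_bool (sorted ?ys) * t * (1 - t) ^ length ?ys + t ^ of_bool (x > y) * ?S)"
  proof (cases "x > y")
    case True
    then have "of_bool (sorted (x # ?ys)) = (0 :: 'a)" by auto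
    with True show ?thesis by (simp only: of_bool_eq) (simp add: algebra_simps)
  next
    case False
    then have "sorted (x # ?ys) \<longleftrightarrow> sorted ?ys" by auto
    with False show ?thesis by (simp add: algebra_simps)
  qed
  finally show ?case
    by (simp only: rec)
qed simp_all

section \<open>Signed words\<close>

text \<open>The absolute values range over an arbitrary set rather than an initial segment of the integers,
  because prefixes of such words are again such words, on a subset of the absolute values.\<close>

definition signed_words :: "int set \<Rightarrow> int list set" where
  "signed_words A = {xs. distinct (map abs xs) \<and> abs ` set xs = A}"

lemma length_signed_word: "xs \<in> signed_words A \<Longrightarrow> length xs = card A"
  unfolding signed_words_def using distinct_card[of "map abs xs"] by auto

lemma finite_signed_words [simp]:
  assumes "finite A"
  shows "finite (signed_words A)"
proof (rule finite_subset)
  show "signed_words A \<subseteq> {xs. set xs \<subseteq> A \<union> uminus ` A \<and> length xs = card A}"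
  proof
    fix xs assume xs: "xs \<in> signed_words A"
    have "x \<in> A \<union> uminus ` A" if "x \<in> set xs" for x
    proof (cases "x \<ge> 0")
      case True
      then show ?thesis using that xs by (force simp: signed_words_def)
    next
      case False
      then have "x = - \<bar>x\<bar>" by simp
      moreover have "\<bar>x\<bar> \<in> A" using that xs by (auto simp: signed_words_def)
      ultimately show ?thesis by blast
    qed
    then show "xs \<in> {xs. set xs \<subseteq> A \<union> uminus ` A \<and> length xs = card A}"
      using length_signed_word[OF xs] by auto
  qed
  show "finite {xs. set xs \<subseteq> A \<union> uminus ` A \<and> length xs = card A}"
    using assms by (intro finite_lists_length_eq) auto
qed

lemma append_in_signed_words:
  "ys @ zs \<in> signed_words A \<longleftrightarrow>
    (\<exists>B\<subseteq>A. ys \<in> signed_words B \<and> zs \<in> signed_words (A - B))"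
proof
  assume "ys @ zs \<in> signed_words A"
  then have "abs ` set ys \<subseteq> A \<and> ys \<in> signed_words (abs ` set ys) \<and> zs \<in> signed_words (A - abs ` set ys)"
    unfolding signed_words_def by auto
  then show "\<exists>B\<subseteq>A. ys \<in> signed_words B \<and> zs \<in> signed_words (A - B)"
    by blast
next
  assume "\<exists>B\<subseteq>A. ys \<in> signed_words B \<and> zs \<in> signed_words (A - B)"
  then show "ys @ zs \<in> signed_words A"
    unfolding signed_words_def by (auto simp: image_Un)
qed

text \<open>A sorted word is determined by its set of letters, hence by which elements of \<open>A\<close> are negated.\<close>

lemma card_sorted_signed_words:
  assumes "finite A" and pos: "\<And>a. a \<in> A \<Longrightarrow> a > 0"
  shows "card {xs \<in> signed_words A. sorted xs} = 2 ^ card A"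
proof -
  let ?g = "\<lambda>N. uminus ` N \<union> (A - N)"
  have "bij_betw (\<lambda>N. sorted_list_of_set (?g N)) (Pow A) {xs \<in> signed_words A. sorted xs}"
  proof (rule bij_betw_byWitness[where f' = "\<lambda>xs. uminus ` {x \<in> set xs. x < 0}"])
    show "\<forall>N\<in>Pow A. uminus ` {x \<in> set (sorted_list_of_set (?g N)). x < 0} = N"
    proof
      fix N assume N: "N \<in> Pow A"
      then have fin: "finite N" using assms(1) finite_subset by auto
      have "{x \<in> ?g N. x < 0} = uminus ` N" using N pos by force
      then show "uminus ` {x \<in> set (sorted_list_of_set (?g N)). x < 0} = N"
        using fin assms(1) by (simp add: image_image)
    qed
    show "\<forall>xs\<in>{xs \<in> signed_words A. sorted xs}.
        sorted_list_of_set (?g (uminus ` {x \<in> set xs. x < 0})) = xs"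
    proof
      fix xs assume xs: "xs \<in> {xs \<in> signed_words A. sorted xs}"
      then have inj: "inj_on abs (set xs)" and im: "abs ` set xs = A" and dist: "distinct xs"
        by (auto simp: signed_words_def distinct_map)
      have "A - uminus ` {x \<in> set xs. x < 0} = {x \<in> set xs. x \<ge> 0}"
      proof (rule set_eqI)
        fix a
        show "a \<in> A - uminus ` {x \<in> set xs. x < 0} \<longleftrightarrow> a \<in> {x \<in> set xs. x \<ge> 0}"
        proof
          assume a: "a \<in> A - uminus ` {x \<in> set xs. x < 0}"
          then obtain x where x: "x \<in> set xs" "a = \<bar>x\<bar>" using im by auto
          have "\<not> x < 0"
          proof
            assume "x < 0"
            then have "a = - x" using x by simp
            then show False using a x \<open>x < 0\<close> by auto
          qed
          then show "a \<in> {x \<in> set xs. x \<ge> 0}" using x by auto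
        next
          assume a: "a \<in> {x \<in> set xs. x \<ge> 0}"
          then have "a \<in> A" using im by force
          moreover have "a \<notin> uminus ` {x \<in> set xs. x < 0}"
          proof
            assume "a \<in> uminus ` {x \<in> set xs. x < 0}"
            then obtain x where "x \<in> set xs" "x < 0" "a = - x" by auto
            then show False using inj_onD[OF inj, of a x] a by auto
          qed
          ultimately show "a \<in> A - uminus ` {x \<in> set xs. x < 0}" by auto
        qed
      qed
      then have "?g (uminus ` {x \<in> set xs. x < 0}) = set xs"
        by (auto simp: image_image)
      then show "sorted_list_of_set (?g (uminus ` {x \<in> set xs. x < 0})) = xs"
        using xs dist by (simp add: sorted_list_of_set.idem_if_sorted_distinct)
    qed
    show "(\<lambda>N. sorted_list_of_set (?g N)) ` Pow A \<subseteq> {xs \<in> signed_words A. sorted xs}"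
    proof
      fix xs assume "xs \<in> (\<lambda>N. sorted_list_of_set (?g N)) ` Pow A"
      then obtain N where N: "N \<subseteq> A" and xs: "xs = sorted_list_of_set (?g N)" by auto
      have fin: "finite (?g N)" using assms(1) N finite_subset by auto
      have "inj_on abs (?g N)"
      proof (rule inj_onI)
        fix x y assume "x \<in> ?g N" "y \<in> ?g N" "\<bar>x\<bar> = \<bar>y\<bar>"
        moreover have "\<And>a. a \<in> N \<Longrightarrow> a > 0" using N pos by auto
        ultimately show "x = y" using pos by (fastforce simp: abs_if split: if_splits)
      qed
      moreover have "abs ` ?g N = A"
      proof -
        have "abs ` uminus ` N = (\<lambda>x. x) ` N" unfolding image_image
          using N pos by (intro image_cong) force+
        moreover have "abs ` (A - N) = (\<lambda>x. x) ` (A - N)"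
          using pos by (intro image_cong) force+
        ultimately show ?thesis using N by (auto simp: image_Un)
      qed
      ultimately show "xs \<in> {xs \<in> signed_words A. sorted xs}"
        using fin xs by (simp add: signed_words_def distinct_map)
    qed
    show "(\<lambda>xs. uminus ` {x \<in> set xs. x < 0}) ` {xs \<in> signed_words A. sorted xs} \<subseteq> Pow A"
      by (force simp: signed_words_def)
  qed
  then show ?thesis
    using assms(1) by (simp add: bij_betw_same_card[symmetric] card_Pow)
qed

section \<open>Cutting off an increasing suffix\<close>

text \<open>Positions in a word start at \<open>0\<close>, so \<open>xs ! 0\<close> and \<open>xs ! 1\<close> are \<open>\<pi>\<^sub>1\<close> and \<open>\<pi>\<^sub>2\<close>. The first
  disjunct is \<open>-\<pi>\<^sub>2 > \<pi>\<^sub>1\<close>.\<close>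

definition initial_descents :: "int list \<Rightarrow> nat set" where
  "initial_descents xs = {i. i = 0 \<and> xs ! 0 + xs ! 1 < 0 \<or> i = 1 \<and> xs ! 0 > xs ! 1}"

definition words_with_start :: "nat set \<Rightarrow> int set \<Rightarrow> int list set" where
  "words_with_start S A = {xs \<in> signed_words A. 2 \<le> length xs \<and> initial_descents xs = S}"

definition sorted_tail_words :: "nat set \<Rightarrow> int set \<Rightarrow> int list set" where
  "sorted_tail_words S A = {xs \<in> words_with_start S A. sorted (tl xs)}"

text \<open>The descents of the tail of \<open>xs\<close> are the descents at positions at least \<open>2\<close>; the initial ones
  contribute the constant factor \<open>t^|S|\<close>, which is left out here.\<close>

definition tail_des_sum :: "'a::comm_ring_1 \<Rightarrow> nat set \<Rightarrow> int set \<Rightarrow> 'a" where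
  "tail_des_sum t S A = (\<Sum>xs\<in>words_with_start S A. t ^ des (tl xs))"

lemma finite_words_with_start [simp]: "finite A \<Longrightarrow> finite (words_with_start S A)"
  by (simp add: words_with_start_def)

lemma append_in_words_with_start:
  assumes "2 \<le> length ys"
  shows "ys @ zs \<in> words_with_start S A \<longleftrightarrow>
    (\<exists>B\<subseteq>A. ys \<in> words_with_start S B \<and> zs \<in> signed_words (A - B))"
proof -
  have "initial_descents (ys @ zs) = initial_descents ys"
    using assms by (auto simp: initial_descents_def nth_append)
  then show ?thesis
    using assms by (auto simp: words_with_start_def append_in_signed_words)
qed

text \<open>Expand each summand by \<open>power_des_eq_sum_sorted_suffix\<close> and exchange the summations: a word
  together with a cut that leaves an increasing suffix is the same as a subset \<open>B\<close>, a word on \<open>B\<close> and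
  an increasing word on \<open>A - B\<close>. The first two letters stay in the prefix, so the initial descents
  are those of the prefix. Since \<open>B = A\<close> is included, the left-hand side occurs on the right with
  coefficient \<open>t\<close>.\<close>

lemma tail_des_sum_rec:
  fixes t :: "'a::comm_ring_1"
  assumes fin: "finite A" and pos: "\<And>a. a \<in> A \<Longrightarrow> a > 0"
  shows "tail_des_sum t S A =
    (1 - t) ^ (card A - 1) * of_nat (card (sorted_tail_words S A))
    + t * (\<Sum>B\<in>Pow A. tail_des_sum t S B * (2 * (1 - t)) ^ card (A - B))"
proof -
  let ?W = "words_with_start S"
  let ?n = "card A"
  have len: "length xs = card C" if "xs \<in> ?W C" for xs C
    using that length_signed_word by (auto simp: words_with_start_def)
  \<comment> \<open>\<open>X\<close>: words with a marked cut; \<open>Y\<close>: pairs of a prefix and an increasing suffix.\<close>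
  define X where "X = (SIGMA xs:?W A. {k \<in> {2..?n}. sorted (drop k xs)})"
  define Y where "Y = (SIGMA B:Pow A. ?W B \<times> {zs \<in> signed_words (A - B). sorted zs})"
  have "t ^ des (tl xs) = of_bool (sorted (tl xs)) * (1 - t) ^ (?n - 1)
     + (\<Sum>k | k \<in> {2..?n} \<and> sorted (drop k xs). t * t ^ des (tl (take k xs)) * (1 - t) ^ (?n - k))"
    if xs: "xs \<in> ?W A" for xs
  proof -
    have n: "length xs = ?n" and "2 \<le> length xs"
      using len[OF xs] xs by (simp_all add: words_with_start_def)
    then have lt: "length (tl xs) = ?n - 1" and sn: "Suc (?n - 1) = ?n" by auto
    have "(\<Sum>k=1..?n - 1. of_bool (sorted (drop k (tl xs))) * t ^ Suc (des (take k (tl xs))) * (1 - t) ^ (?n - 1 - k))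
       = (\<Sum>k=1..?n - 1. of_bool (sorted (drop (Suc k) xs)) * t ^ Suc (des (tl (take (Suc k) xs))) * (1 - t) ^ (?n - Suc k))"
      by (intro sum.cong refl) (simp add: drop_Suc tl_take)
    also have "\<dots> = (\<Sum>k=2..?n. of_bool (sorted (drop k xs)) * t ^ Suc (des (tl (take k xs))) * (1 - t) ^ (?n - k))"
      using sum.atLeast_Suc_atMost_Suc_shift[of "\<lambda>k. of_bool (sorted (drop k xs)) * t ^ Suc (des (tl (take k xs))) * (1 - t) ^ (?n - k)" 1 "?n - 1"]
      unfolding sn by (simp add: numeral_2_eq_2)
    also have "\<dots> = (\<Sum>k | k \<in> {2..?n} \<and> sorted (drop k xs). t * t ^ des (tl (take k xs)) * (1 - t) ^ (?n - k))"
      by (intro sum.mono_neutral_cong_right) auto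
    finally show ?thesis
      using power_des_eq_sum_sorted_suffix[of t "tl xs"] unfolding lt by simp
  qed
  then have "tail_des_sum t S A = (\<Sum>xs\<in>?W A. of_bool (sorted (tl xs)) * (1 - t) ^ (?n - 1))
     + (\<Sum>xs\<in>?W A. \<Sum>k | k \<in> {2..?n} \<and> sorted (drop k xs). t * t ^ des (tl (take k xs)) * (1 - t) ^ (?n - k))"
    by (simp add: tail_des_sum_def sum.distrib)
  also have "(\<Sum>xs\<in>?W A. of_bool (sorted (tl xs)) * (1 - t) ^ (?n - 1))
     = (1 - t) ^ (?n - 1) * of_nat (card (sorted_tail_words S A))"
    using fin by (simp add: sorted_tail_words_def sum_of_bool_eq Int_def mult.commute flip: sum_distrib_right)
  also have "(\<Sum>xs\<in>?W A. \<Sum>k | k \<in> {2..?n} \<and> sorted (drop k xs). t * t ^ des (tl (take k xs)) * (1 - t) ^ (?n - k))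
     = (\<Sum>(xs, k)\<in>X. t * t ^ des (tl (take k xs)) * (1 - t) ^ (?n - k))"
    using fin unfolding X_def by (subst sum.Sigma) auto
  also have "\<dots> = (\<Sum>(B, ys, zs)\<in>Y. t * t ^ des (tl ys) * (1 - t) ^ card (A - B))"
  proof (rule sum.reindex_bij_witness[where
        i = "\<lambda>(B, ys, zs). (ys @ zs, length ys)" and
        j = "\<lambda>(xs, k). (abs ` set (take k xs), take k xs, drop k xs)"])
    fix p assume "p \<in> X"
    then obtain xs k where p: "p = (xs, k)" "xs \<in> ?W A" "2 \<le> k" "k \<le> ?n" "sorted (drop k xs)"
      by (auto simp: X_def)
    have n: "length xs = ?n" using len p(2) .
    then have "2 \<le> length (take k xs)" using p by simp
    then obtain B where B: "B \<subseteq> A" "take k xs \<in> ?W B" "drop k xs \<in> signed_words (A - B)"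
      using append_in_words_with_start[of "take k xs" "drop k xs" S A] p(2) by auto
    have B': "abs ` set (take k xs) = B"
      using B(2) by (simp add: words_with_start_def signed_words_def)
    show "(case case p of (xs, k) \<Rightarrow> (abs ` set (take k xs), take k xs, drop k xs) of
        (B, ys, zs) \<Rightarrow> (ys @ zs, length ys)) = p"
      using p n by simp
    show "(case p of (xs, k) \<Rightarrow> (abs ` set (take k xs), take k xs, drop k xs)) \<in> Y"
      using B B' p by (simp add: Y_def)
    have "card (A - B) = ?n - k"
      using length_signed_word[OF B(3)] n by simp
    then show "(case case p of (xs, k) \<Rightarrow> (abs ` set (take k xs), take k xs, drop k xs) of
        (B, ys, zs) \<Rightarrow> t * t ^ des (tl ys) * (1 - t) ^ card (A - B)) =
        (case p of (xs, k) \<Rightarrow> t * t ^ des (tl (take k xs)) * (1 - t) ^ (?n - k))"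
      using p(1) B' by simp
  next
    fix q assume "q \<in> Y"
    then obtain B ys zs where q: "q = (B, ys, zs)" "B \<subseteq> A" "ys \<in> ?W B"
        "zs \<in> signed_words (A - B)" "sorted zs"
      by (auto simp: Y_def)
    then have l: "2 \<le> length ys" and B: "abs ` set ys = B"
      by (auto simp: words_with_start_def signed_words_def)
    have xs: "ys @ zs \<in> ?W A"
      using append_in_words_with_start[OF l] q by blast
    show "(case case q of (B, ys, zs) \<Rightarrow> (ys @ zs, length ys) of
        (xs, k) \<Rightarrow> (abs ` set (take k xs), take k xs, drop k xs)) = q"
      using q B by simp
    show "(case q of (B, ys, zs) \<Rightarrow> (ys @ zs, length ys)) \<in> X"
      using q l xs len[OF xs] by (simp add: X_def)
  qed
  also have "\<dots> = (\<Sum>B\<in>Pow A. \<Sum>(ys, zs)\<in>?W B \<times> {zs \<in> signed_words (A - B). sorted zs}.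
      t * t ^ des (tl ys) * (1 - t) ^ card (A - B))"
    unfolding Y_def using fin finite_subset[OF _ fin] by (subst sum.Sigma) auto
  also have "\<dots> = (\<Sum>B\<in>Pow A. t * (tail_des_sum t S B * (2 * (1 - t)) ^ card (A - B)))"
  proof (rule sum.cong[OF refl])
    fix B assume "B \<in> Pow A"
    then have c: "card {zs \<in> signed_words (A - B). sorted zs} = 2 ^ card (A - B)"
      using fin pos by (intro card_sorted_signed_words) auto
    have "(\<Sum>(ys, zs)\<in>?W B \<times> {zs \<in> signed_words (A - B). sorted zs}.
        t * t ^ des (tl ys) * (1 - t) ^ card (A - B))
      = (\<Sum>ys\<in>?W B. 2 ^ card (A - B) * (t * t ^ des (tl ys) * (1 - t) ^ card (A - B)))"
      by (simp add: c flip: sum.cartesian_product)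
    also have "\<dots> = t * (tail_des_sum t S B * (2 * (1 - t)) ^ card (A - B))"
      unfolding tail_des_sum_def sum_distrib_left sum_distrib_right power_mult_distrib
      by (simp add: mult_ac)
    finally show "(\<Sum>(ys, zs)\<in>?W B \<times> {zs \<in> signed_words (A - B). sorted zs}.
        t * t ^ des (tl ys) * (1 - t) ^ card (A - B))
      = t * (tail_des_sum t S B * (2 * (1 - t)) ^ card (A - B))" .
  qed
  finally show ?thesis
    by (simp add: sum_distrib_left)
qed

section \<open>Words with sorted tail\<close>

lemma Cons_in_signed_words:
  "x # xs \<in> signed_words A \<longleftrightarrow> \<bar>x\<bar> \<in> A \<and> xs \<in> signed_words (A - {\<bar>x\<bar>})"
proof -
  have insert: "a \<notin> Y \<and> insert a Y = A \<longleftrightarrow> a \<in> A \<and> Y = A - {a}" for a Y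
    by auto
  have "x # xs \<in> signed_words A \<longleftrightarrow>
      (\<bar>x\<bar> \<notin> abs ` set xs \<and> insert \<bar>x\<bar> (abs ` set xs) = A) \<and> distinct (map abs xs)"
    by (simp add: signed_words_def conj_ac)
  also have "\<dots> \<longleftrightarrow> (\<bar>x\<bar> \<in> A \<and> abs ` set xs = A - {\<bar>x\<bar>}) \<and> distinct (map abs xs)"
    unfolding insert ..
  also have "\<dots> \<longleftrightarrow> \<bar>x\<bar> \<in> A \<and> xs \<in> signed_words (A - {\<bar>x\<bar>})"
    by (simp only: signed_words_def mem_Collect_eq conj_ac)
  finally show ?thesis .
qed

lemma initial_descents_cases:
  assumes "\<bar>x\<bar> \<noteq> \<bar>y\<bar>"
  shows "initial_descents (x # y # zs) = {} \<longleftrightarrow> x < y \<and> 0 < x + y"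
    and "initial_descents (x # y # zs) = {0} \<longleftrightarrow> x < y \<and> x + y < 0"
    and "initial_descents (x # y # zs) = {1} \<longleftrightarrow> y < x \<and> 0 < x + y"
    and "initial_descents (x # y # zs) = {0, 1} \<longleftrightarrow> y < x \<and> x + y < 0"
proof -
  have "initial_descents (x # y # zs) = (if x + y < 0 then {0} else {}) \<union> (if x > y then {1} else {})"
    by (auto simp: initial_descents_def)
  moreover have "x \<noteq> y" "x + y \<noteq> 0" using assms by auto
  ultimately show "initial_descents (x # y # zs) = {} \<longleftrightarrow> x < y \<and> 0 < x + y"
    and "initial_descents (x # y # zs) = {0} \<longleftrightarrow> x < y \<and> x + y < 0"
    and "initial_descents (x # y # zs) = {1} \<longleftrightarrow> y < x \<and> 0 < x + y"
    and "initial_descents (x # y # zs) = {0, 1} \<longleftrightarrow> y < x \<and> x + y < 0"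
    by (auto simp: doubleton_eq_iff)
qed

lemma sorted_tail_words_iff:
  "xs \<in> sorted_tail_words S A \<longleftrightarrow>
    (\<exists>x y zs. xs = x # y # zs \<and> \<bar>x\<bar> \<noteq> \<bar>y\<bar> \<and> xs \<in> signed_words A \<and> sorted (y # zs)
       \<and> initial_descents xs = S)"
proof (cases xs rule: des.cases)
  case (3 x y zs)
  have "x # y # zs \<in> signed_words A \<Longrightarrow> \<bar>x\<bar> \<noteq> \<bar>y\<bar>"
    by (auto simp: signed_words_def)
  with 3 show ?thesis
    by (auto simp: sorted_tail_words_def words_with_start_def)
qed (auto simp: sorted_tail_words_def words_with_start_def)

text \<open>Here the second letter exceeds the absolute value of the first, so all letters after the first
  are positive and the absolute values increase: only the sign of the smallest one is free.\<close>

lemma card_sorted_tail_words_empty: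
  assumes fin: "finite A" and pos: "\<And>a. a \<in> A \<Longrightarrow> a > 0" and "2 \<le> card A"
  shows "card (sorted_tail_words {} A) = 2"
proof -
  obtain m ms where A: "sorted_list_of_set A = m # ms" "ms \<noteq> []"
  proof -
    have "length (sorted_list_of_set A) = card A" by simp
    then show thesis using assms(3) that
      by (cases "sorted_list_of_set A" rule: des.cases) auto
  qed
  have "set (m # ms) = A" "sorted (m # ms)" "distinct (m # ms)"
    unfolding A(1)[symmetric] using fin by auto
  obtain y zs where ms: "ms = y # zs" using A(2) by (cases ms) auto
  have W: "x # ms \<in> signed_words A" if "\<bar>x\<bar> = m" for x
  proof -
    have "map abs ms = map (\<lambda>x. x) ms"
      using pos \<open>set (m # ms) = A\<close> by (intro map_cong) force+
    then have "map abs (x # ms) = m # ms" using that by simp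
    then show ?thesis
      using \<open>set (m # ms) = A\<close> \<open>distinct (m # ms)\<close>
      unfolding signed_words_def by (metis (mono_tags, lifting) list.set_map mem_Collect_eq)
  qed
  have m: "0 < m" "m < y" "y \<in> A" "sorted ms"
    using \<open>set (m # ms) = A\<close> \<open>sorted (m # ms)\<close> \<open>distinct (m # ms)\<close> pos by (auto simp: ms order_less_le)
  have "sorted_tail_words {} A = {m # ms, - m # ms}"
  proof (intro subset_antisym subsetI)
    fix xs assume "xs \<in> sorted_tail_words {} A"
    then obtain x y' zs' where xs: "xs = x # y' # zs'" "\<bar>x\<bar> \<noteq> \<bar>y'\<bar>" "xs \<in> signed_words A"
      "sorted (y' # zs')" "x < y'" "0 < x + y'"
      using initial_descents_cases(1) by (auto simp: sorted_tail_words_iff)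
    then have "\<bar>x\<bar> < y'" by auto
    then have abs: "map abs (y' # zs') = y' # zs'"
      using xs(4) by (auto intro!: map_idI)
    then have *: "map abs xs = \<bar>x\<bar> # y' # zs'" using xs(1) by simp
    have "sorted (map abs xs)" unfolding * using xs(4) \<open>\<bar>x\<bar> < y'\<close> by auto
    moreover have "distinct (map abs xs)" "set (map abs xs) = A"
      using xs(3) by (auto simp: signed_words_def)
    ultimately have "map abs xs = m # ms"
      using A(1) sorted_list_of_set.idem_if_sorted_distinct by metis
    then have "\<bar>x\<bar> = m" "y' # zs' = ms" using * by auto
    then show "xs \<in> {m # ms, - m # ms}" using xs(1) by (auto simp: abs_if split: if_splits)
  next
    fix xs assume "xs \<in> {m # ms, - m # ms}"
    then obtain x where x: "xs = x # ms" "\<bar>x\<bar> = m" using m(1) by auto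
    then have "initial_descents xs = {}"
      unfolding x(1) ms using m by (subst initial_descents_cases(1)) auto
    then show "xs \<in> sorted_tail_words {} A"
      using W[OF x(2)] x m by (auto simp: sorted_tail_words_iff ms)
  qed
  then show ?thesis using m(1) by auto
qed

text \<open>Negating \<open>x\<close> exchanges \<open>x < y \<and> x + y < 0\<close> with \<open>y < x \<and> 0 < x + y\<close> up to exchanging the
  order of the two conditions, and leaves the tail alone.\<close>

lemma card_sorted_tail_words_1_eq_0:
  "card (sorted_tail_words {1} A) = card (sorted_tail_words {0} A)"
proof -
  define neg where "neg = (\<lambda>xs. - hd xs # tl xs :: int list)"
  have neg: "neg xs \<in> sorted_tail_words (if S = {0} then {1} else {0}) A"
    if mem: "xs \<in> sorted_tail_words S A" and S: "S = {0} \<or> S = {1}" for xs S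
  proof -
    obtain x y zs where xs: "xs = x # y # zs" "\<bar>x\<bar> \<noteq> \<bar>y\<bar>" "xs \<in> signed_words A" "sorted (y # zs)"
      "initial_descents xs = S"
      using mem unfolding sorted_tail_words_iff by blast
    have ne: "\<bar>- x\<bar> \<noteq> \<bar>y\<bar>" using xs(2) by simp
    have "initial_descents (x # y # zs) = {0} \<longleftrightarrow> initial_descents (- x # y # zs) = {1}"
      "initial_descents (x # y # zs) = {1} \<longleftrightarrow> initial_descents (- x # y # zs) = {0}"
      unfolding initial_descents_cases(2,3)[OF xs(2)] initial_descents_cases(2,3)[OF ne] by auto
    then have "initial_descents (- x # y # zs) = (if S = {0} then {1} else {0})"
      using S xs(1,5) by fastforce
    then show ?thesis
      using xs by (auto simp: sorted_tail_words_iff neg_def Cons_in_signed_words)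
  qed
  have "bij_betw neg (sorted_tail_words {1} A) (sorted_tail_words {0} A)"
  proof (rule bij_betw_byWitness[where f' = neg])
    show "neg ` sorted_tail_words {1} A \<subseteq> sorted_tail_words {0} A"
      using neg[of _ "{1}"] by auto
    show "neg ` sorted_tail_words {0} A \<subseteq> sorted_tail_words {1} A"
      using neg[of _ "{0}"] by auto
  qed (auto simp: neg_def sorted_tail_words_iff)
  then show ?thesis by (rule bij_betw_same_card)
qed

text \<open>Together the two sets make up the words that are increasing throughout.\<close>

lemma card_sorted_tail_words_empty_plus_0:
  assumes fin: "finite A" and pos: "\<And>a. a \<in> A \<Longrightarrow> a > 0" and "2 \<le> card A"
  shows "card (sorted_tail_words {} A) + card (sorted_tail_words {0} A) = 2 ^ card A"
proof -
  have "sorted_tail_words {} A \<union> sorted_tail_words {0} A = {xs \<in> signed_words A. sorted xs}"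
  proof (rule set_eqI)
    fix xs
    show "xs \<in> sorted_tail_words {} A \<union> sorted_tail_words {0} A \<longleftrightarrow> xs \<in> {xs \<in> signed_words A. sorted xs}"
    proof (cases xs rule: des.cases)
      case (3 x y zs)
      show ?thesis
      proof (cases "xs \<in> signed_words A")
        case True
        then have "\<bar>x\<bar> \<noteq> \<bar>y\<bar>" using 3 by (auto simp: signed_words_def)
        then show ?thesis
          using True initial_descents_cases(1,2)[of x y zs] by (auto simp: 3 sorted_tail_words_iff)
      qed (auto simp: sorted_tail_words_iff)
    qed (use assms(3) length_signed_word[of xs A] in \<open>auto simp: sorted_tail_words_iff\<close>)
  qed
  moreover have "finite (sorted_tail_words S A)" for S
    using fin by (simp add: sorted_tail_words_def)
  moreover have "sorted_tail_words {} A \<inter> sorted_tail_words {0} A = {}"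
    by (auto simp: sorted_tail_words_iff)
  ultimately show ?thesis
    using card_Un_disjoint[of "sorted_tail_words {} A" "sorted_tail_words {0} A"]
      card_sorted_signed_words[OF fin pos] by simp
qed

text \<open>Both sides count the words with increasing tail: on the right by their first letter
  (\<open>2 m\<close> choices, then \<open>2^(m - 1)\<close> sign patterns of the tail), on the left by whether the first
  two letters increase.\<close>

lemma card_sorted_tail_words_1_plus_01:
  assumes fin: "finite A" and pos: "\<And>a. a \<in> A \<Longrightarrow> a > 0" and "2 \<le> card A"
  shows "2 ^ card A + (card (sorted_tail_words {1} A) + card (sorted_tail_words {0, 1} A))
    = card A * 2 ^ card A"
proof -
  let ?T = "{xs \<in> signed_words A. sorted (tl xs)}"
  let ?P = "{xs \<in> signed_words A. sorted xs}"
  have finT: "finite (sorted_tail_words S A)" for S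
    using fin by (simp add: sorted_tail_words_def)
  have "?T = ?P \<union> (sorted_tail_words {1} A \<union> sorted_tail_words {0, 1} A)"
  proof (rule set_eqI)
    fix xs
    show "xs \<in> ?T \<longleftrightarrow> xs \<in> ?P \<union> (sorted_tail_words {1} A \<union> sorted_tail_words {0, 1} A)"
    proof (cases xs rule: des.cases)
      case (3 x y zs)
      show ?thesis
      proof (cases "xs \<in> signed_words A")
        case True
        then have "\<bar>x\<bar> \<noteq> \<bar>y\<bar>" using 3 by (auto simp: signed_words_def)
        then show ?thesis
          using True initial_descents_cases(3,4)[of x y zs] by (auto simp: 3 sorted_tail_words_iff)
      qed (auto simp: sorted_tail_words_iff)
    qed (use assms(3) length_signed_word[of xs A] in \<open>auto simp: sorted_tail_words_iff\<close>)
  qed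
  moreover have "sorted_tail_words {1} A \<inter> sorted_tail_words {0, 1} A = {}"
    by (auto simp: sorted_tail_words_iff)
  moreover have "?P \<inter> (sorted_tail_words {1} A \<union> sorted_tail_words {0, 1} A) = {}"
    using initial_descents_cases(3,4) by (fastforce simp: sorted_tail_words_iff)
  ultimately have "card ?T = card ?P + (card (sorted_tail_words {1} A) + card (sorted_tail_words {0, 1} A))"
    using fin finT by (simp add: card_Un_disjoint)
  moreover have "card ?T = card A * 2 ^ card A"
  proof -
    let ?Z = "SIGMA x:A \<union> uminus ` A. {zs \<in> signed_words (A - {\<bar>x\<bar>}). sorted zs}"
    have absA: "\<bar>x\<bar> \<in> A \<longleftrightarrow> x \<in> A \<union> uminus ` A" for x
      using pos[of x] pos[of "- x"] by (force simp: abs_if image_iff)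
    have "?T = (\<lambda>(x, zs). x # zs) ` ?Z"
    proof (rule set_eqI)
      fix xs show "xs \<in> ?T \<longleftrightarrow> xs \<in> (\<lambda>(x, zs). x # zs) ` ?Z"
      proof (cases xs)
        case Nil
        then show ?thesis using length_signed_word[of xs A] assms(3) by auto
      next
        case (Cons x zs)
        then show ?thesis using absA[of x] by (auto simp: Cons_in_signed_words image_iff)
      qed
    qed
    moreover have "inj_on (\<lambda>(x, zs). x # zs) ?Z" by (auto simp: inj_on_def)
    ultimately have "card ?T = card ?Z" by (simp add: card_image)
    also have "\<dots> = (\<Sum>x\<in>A \<union> uminus ` A. card {zs \<in> signed_words (A - {\<bar>x\<bar>}). sorted zs})"
      using fin by (intro card_SigmaI) auto
    also have "\<dots> = (\<Sum>x\<in>A \<union> uminus ` A. 2 ^ (card A - 1))"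
    proof (rule sum.cong[OF refl])
      fix x assume "x \<in> A \<union> uminus ` A"
      then have "card (A - {\<bar>x\<bar>}) = card A - 1" using absA fin by (simp add: card_Diff_singleton)
      then show "card {zs \<in> signed_words (A - {\<bar>x\<bar>}). sorted zs} = 2 ^ (card A - 1)"
        using card_sorted_signed_words[of "A - {\<bar>x\<bar>}"] fin pos by auto
    qed
    also have "\<dots> = card (A \<union> uminus ` A) * 2 ^ (card A - 1)" by simp
    also have "card (A \<union> uminus ` A) = 2 * card A"
    proof -
      have "- a \<notin> A" if "a \<in> A" for a using pos[OF that] pos[of "- a"] by auto
      then have "A \<inter> uminus ` A = {}" by auto
      then show ?thesis using fin by (simp add: card_Un_disjoint card_image)
    qed
    also have "2 * card A * 2 ^ (card A - 1) = card A * 2 ^ card A"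
      using assms(3) by (cases "card A") auto
    finally show ?thesis .
  qed
  ultimately show ?thesis
    using card_sorted_signed_words[OF fin pos] by simp
qed

section \<open>Signed permutations\<close>

context
  fixes n :: nat and \<pi> :: "int \<Rightarrow> int"
  assumes \<pi>: "\<pi> \<in> signed_perms n"
begin

lemma signed_perm_permutes: "\<pi> permutes {- int n..int n}"
  and signed_perm_minus: "\<pi> (- i) = - \<pi> i"
  using \<pi> by (auto simp: signed_perms_def)

lemma signed_perm_0: "\<pi> 0 = 0"
  using signed_perm_minus[of 0] by simp

lemma signed_perm_eq_iff: "\<pi> i = \<pi> j \<longleftrightarrow> i = j"
  using permutes_inj[OF signed_perm_permutes] by (auto dest: injD)

lemma signed_perm_eq_0_iff: "\<pi> i = 0 \<longleftrightarrow> i = 0"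
  using signed_perm_eq_iff[of i 0] signed_perm_0 by simp

lemma abs_signed_perm_eq_iff: "\<bar>\<pi> i\<bar> = \<bar>\<pi> j\<bar> \<longleftrightarrow> \<bar>i\<bar> = \<bar>j\<bar>"
  unfolding abs_eq_iff signed_perm_minus[symmetric] signed_perm_eq_iff ..

lemma abs_signed_perm_in: "i \<in> {1..int n} \<Longrightarrow> \<bar>\<pi> i\<bar> \<in> {1..int n}"
  using permutes_in_image[OF signed_perm_permutes, of i] signed_perm_eq_0_iff[of i] by auto

end

lemma finite_signed_perms [simp]: "finite (signed_perms n)"
  unfolding signed_perms_def
  by (rule finite_subset[OF _ finite_permutations[of "{- int n..int n}"]]) auto

lemma finite_D_perms: "finite (D_perms n)"
  by (simp add: D_perms_def)

text \<open>Composition with \<open>transpose 1 (- 1)\<close> changes the sign of the letter of absolute value \<open>1\<close>. As no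
  other letter is that small, comparisons between letters of different absolute values survive.\<close>

lemma flip_less_iff:
  fixes a b :: int
  assumes "\<bar>a\<bar> \<noteq> \<bar>b\<bar>" "a \<noteq> 0" "b \<noteq> 0"
  shows "transpose 1 (- 1) a < transpose 1 (- 1) b \<longleftrightarrow> a < b"
  using assms by (auto simp: transpose_def)

lemma flip_minus: "transpose 1 (- 1) (- a) = - transpose 1 (- 1) (a :: int)"
  by (auto simp: transpose_def)

lemma flip_signed_perm:
  assumes "\<pi> \<in> signed_perms n" "1 \<le> n"
  shows "transpose 1 (- 1) \<circ> \<pi> \<in> signed_perms n"
proof -
  have "transpose 1 (- 1) permutes {- int n..int n}"
    using assms(2) by (intro permutes_swap_id) auto
  then show ?thesis
    using assms(1) permutes_compose by (auto simp: signed_perms_def flip_minus)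
qed

lemma D_descents_flip:
  assumes \<pi>: "\<pi> \<in> signed_perms n"
  shows "D_descents n (transpose 1 (- 1) \<circ> \<pi>) = D_descents n \<pi>"
proof -
  have "D_entry (transpose 1 (- 1) \<circ> \<pi>) i = transpose 1 (- 1) (D_entry \<pi> i)" for i
    by (simp add: D_entry_def flip_minus)
  moreover have "\<bar>D_entry \<pi> i\<bar> \<noteq> \<bar>D_entry \<pi> (i + 1)\<bar>" "D_entry \<pi> i \<noteq> 0" for i
    using abs_signed_perm_eq_iff[OF \<pi>] signed_perm_eq_0_iff[OF \<pi>] by (auto simp: D_entry_def)
  ultimately have "D_entry (transpose 1 (- 1) \<circ> \<pi>) (i + 1) < D_entry (transpose 1 (- 1) \<circ> \<pi>) i
      \<longleftrightarrow> D_entry \<pi> (i + 1) < D_entry \<pi> i" for i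
    by (metis flip_less_iff)
  then show ?thesis by (simp add: D_descents_def)
qed

lemma flip_in_D_perms_iff:
  assumes \<pi>: "\<pi> \<in> signed_perms n" and n: "1 \<le> n"
  shows "transpose 1 (- 1) \<circ> \<pi> \<in> D_perms n \<longleftrightarrow> \<pi> \<notin> D_perms n"
proof -
  let ?\<rho> = "transpose 1 (- 1) \<circ> \<pi>"
  let ?N = "\<lambda>\<pi>. {i \<in> {1..int n}. \<pi> i < (0::int)}"
  \<comment> \<open>\<open>\<bar>j\<bar>\<close> will be the position of the letter \<open>\<plusminus>1\<close>, the only one whose sign changes.\<close>
  have "1 \<in> \<pi> ` {- int n..int n}"
    using permutes_image[OF signed_perm_permutes[OF \<pi>]] n by simp
  then obtain j where j: "j \<in> {- int n..int n}" "\<pi> j = 1" by auto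
  then have k: "\<bar>j\<bar> \<in> {1..int n}" "\<bar>\<pi> \<bar>j\<bar>\<bar> = 1"
    using signed_perm_0[OF \<pi>] abs_signed_perm_eq_iff[OF \<pi>, of "\<bar>j\<bar>" j] by (cases "j = 0"; auto)+
  have other: "?\<rho> i = \<pi> i" if "i \<in> {1..int n}" "i \<noteq> \<bar>j\<bar>" for i
    using that k(2) abs_signed_perm_eq_iff[OF \<pi>, of i "\<bar>j\<bar>"] by (auto simp: transpose_def)
  have at: "?\<rho> \<bar>j\<bar> = - \<pi> \<bar>j\<bar>"
    using k(2) by (auto simp: transpose_def abs_if split: if_splits)
  have parity: "even (card X) \<longleftrightarrow> odd (card Y)" if "X = insert k Y" "k \<notin> Y" "finite Y" for X Y and k :: int
    using that by simp
  have "even (card (?N ?\<rho>)) \<longleftrightarrow> odd (card (?N \<pi>))"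
  proof (cases "\<pi> \<bar>j\<bar> < 0")
    case True
    have "i \<in> ?N \<pi> \<longleftrightarrow> i \<in> insert \<bar>j\<bar> (?N ?\<rho>)" for i
      using True k(1) other[of i] by (cases "i = \<bar>j\<bar>") (simp_all del: comp_apply cong: conj_cong)
    then have "?N \<pi> = insert \<bar>j\<bar> (?N ?\<rho>)" by blast
    moreover have "\<bar>j\<bar> \<notin> ?N ?\<rho>" using True at by (simp del: comp_apply)
    ultimately have "even (card (?N \<pi>)) \<longleftrightarrow> odd (card (?N ?\<rho>))" by (rule parity) (rule finite_subset[of _ "{1..int n}"], auto)
    then show ?thesis by blast
  next
    case False
    then have "\<pi> \<bar>j\<bar> > 0" using k(2) by linarith
    then have "i \<in> ?N ?\<rho> \<longleftrightarrow> i \<in> insert \<bar>j\<bar> (?N \<pi>)" for i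
      using k(1) at other[of i] by (cases "i = \<bar>j\<bar>") (simp_all del: comp_apply cong: conj_cong)
    then have "?N ?\<rho> = insert \<bar>j\<bar> (?N \<pi>)" by blast
    moreover have "\<bar>j\<bar> \<notin> ?N \<pi>" using False by simp
    ultimately show ?thesis by (rule parity) (rule finite_subset[of _ "{1..int n}"], auto)
  qed
  then show ?thesis
    using \<pi> flip_signed_perm[OF \<pi> n] by (simp add: D_perms_def del: comp_apply)
qed

text \<open>The sign change is a bijection from \<open>D_n\<close> to its complement that preserves descent sets.\<close>

lemma sum_signed_perms_eq_double_sum_D_perms:
  fixes h :: "nat set \<Rightarrow> 'a::comm_ring_1"
  assumes n: "1 \<le> n"
  shows "(\<Sum>\<pi>\<in>signed_perms n. h (D_descents n \<pi>)) = 2 * (\<Sum>\<pi>\<in>D_perms n. h (D_descents n \<pi>))"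
proof -
  let ?flip = "\<lambda>\<pi>. transpose 1 (- 1) \<circ> \<pi> :: int \<Rightarrow> int"
  have D: "D_perms n \<subseteq> signed_perms n" by (auto simp: D_perms_def)
  have "bij_betw ?flip (D_perms n) (signed_perms n - D_perms n)"
  proof (rule bij_betw_byWitness[where f' = ?flip])
    show "?flip ` D_perms n \<subseteq> signed_perms n - D_perms n"
      using flip_signed_perm flip_in_D_perms_iff D n by blast
    show "?flip ` (signed_perms n - D_perms n) \<subseteq> D_perms n"
      using flip_in_D_perms_iff n by blast
  qed (auto simp: fun_eq_iff)
  then have "(\<Sum>\<pi>\<in>signed_perms n - D_perms n. h (D_descents n \<pi>))
      = (\<Sum>\<pi>\<in>D_perms n. h (D_descents n (?flip \<pi>)))"
    by (rule sum.reindex_bij_betw[symmetric])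
  also have "\<dots> = (\<Sum>\<pi>\<in>D_perms n. h (D_descents n \<pi>))"
    using D D_descents_flip by (intro sum.cong) auto
  finally show ?thesis
    using sum.subset_diff[OF D finite_signed_perms, of "\<lambda>\<pi>. h (D_descents n \<pi>)"] by simp
qed

lemma bij_betw_signed_perms_signed_words:
  "bij_betw (\<lambda>\<pi>. map \<pi> [1..int n]) (signed_perms n) (signed_words {1..int n})"
proof (rule bij_betwI')
  fix \<pi> \<rho> assume \<pi>: "\<pi> \<in> signed_perms n" and \<rho>: "\<rho> \<in> signed_perms n"
  show "map \<pi> [1..int n] = map \<rho> [1..int n] \<longleftrightarrow> \<pi> = \<rho>"
  proof
    assume "map \<pi> [1..int n] = map \<rho> [1..int n]"
    then have pos: "\<pi> i = \<rho> i" if "i \<in> {1..int n}" for i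
      using that by auto
    show "\<pi> = \<rho>"
    proof
      fix i
      consider "i = 0" | "i \<in> {1..int n}" | "- i \<in> {1..int n}" | "i \<notin> {- int n..int n}"
        by fastforce
      then show "\<pi> i = \<rho> i"
      proof cases
        case 3
        then show ?thesis
          using pos[of "- i"] by (simp add: signed_perm_minus[OF \<pi>] signed_perm_minus[OF \<rho>])
      next
        case 4
        then show ?thesis
          using permutes_not_in signed_perm_permutes[OF \<pi>] signed_perm_permutes[OF \<rho>] by metis
      qed (use pos signed_perm_0[OF \<pi>] signed_perm_0[OF \<rho>] in auto)
    qed
  qed simp
next
  fix \<pi> assume \<pi>: "\<pi> \<in> signed_perms n"
  have inj: "inj_on (\<lambda>i. \<bar>\<pi> i\<bar>) {1..int n}"
    by (rule inj_onI) (auto simp: abs_signed_perm_eq_iff[OF \<pi>])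
  moreover have "(\<lambda>i. \<bar>\<pi> i\<bar>) ` {1..int n} = {1..int n}"
    using abs_signed_perm_in[OF \<pi>] inj by (intro endo_inj_surj) blast+
  moreover have "map abs (map \<pi> [1..int n]) = map (\<lambda>i. \<bar>\<pi> i\<bar>) [1..int n]"
    by simp
  moreover have "distinct (map (\<lambda>i. \<bar>\<pi> i\<bar>) [1..int n])"
    unfolding distinct_map using inj by simp
  ultimately show "map \<pi> [1..int n] \<in> signed_words {1..int n}"
    unfolding signed_words_def mem_Collect_eq by (simp only: set_map image_image set_upto)
next
  fix xs assume xs: "xs \<in> signed_words {1..int n}"
  have len: "length xs = n" using length_signed_word[OF xs] by simp
  define m where "m i = nat (\<bar>i\<bar> - 1)" for i :: int
  define \<pi> where "\<pi> i = (if i \<in> {- int n..int n} \<and> i \<noteq> 0 then sgn i * xs ! m i else i)" for i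
  have m: "m i < length xs" if "i \<in> {- int n..int n}" "i \<noteq> 0" for i
    using that len by (auto simp: m_def)
  have xs_abs: "\<bar>xs ! k\<bar> \<in> {1..int n}" if "k < length xs" for k
    using xs nth_mem[OF that] unfolding signed_words_def by blast
  have abs: "\<bar>\<pi> i\<bar> = \<bar>xs ! m i\<bar>" if "i \<in> {- int n..int n}" "i \<noteq> 0" for i
    using that by (simp add: \<pi>_def abs_mult)
  have "inj_on \<pi> {- int n..int n}"
  proof (rule inj_onI)
    fix i j assume i: "i \<in> {- int n..int n}" and j: "j \<in> {- int n..int n}" and eq: "\<pi> i = \<pi> j"
    have nz: "\<pi> i = 0 \<longleftrightarrow> i = 0" if "i \<in> {- int n..int n}" for i
      using abs[OF that] xs_abs[OF m[OF that]] by (auto simp: \<pi>_def)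
    show "i = j"
    proof (cases "i = 0 \<or> j = 0")
      case True
      then show ?thesis using nz[OF i] nz[OF j] eq by auto
    next
      case False
      then have "map abs xs ! m i = map abs xs ! m j"
        using abs[OF i] abs[OF j] eq m[OF i] m[OF j] by simp
      then have "m i = m j"
        using xs False m[OF i] m[OF j] by (subst (asm) nth_eq_iff_index_eq) (auto simp: signed_words_def)
      then have "\<bar>i\<bar> = \<bar>j\<bar>" using False by (auto simp: m_def)
      moreover have "sgn i = sgn j"
      proof -
        have "xs ! m i \<noteq> 0" using xs_abs[OF m[OF i]] False by auto
        then show ?thesis using eq False i j \<open>m i = m j\<close> by (simp add: \<pi>_def)
      qed
      ultimately show ?thesis by (metis mult_sgn_abs)
    qed
  qed
  moreover have "\<pi> i \<in> {- int n..int n}" if "i \<in> {- int n..int n}" for i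
  proof (cases "i = 0")
    case False
    then show ?thesis using abs[OF that] xs_abs[OF m[OF that]] by auto
  qed (simp add: \<pi>_def)
  ultimately have "\<pi> permutes {- int n..int n}"
    by (intro inj_imp_permutes) (auto simp: \<pi>_def)
  moreover have "\<pi> (- i) = - \<pi> i" for i
    by (auto simp: \<pi>_def m_def sgn_minus)
  ultimately have "\<pi> \<in> signed_perms n" by (simp add: signed_perms_def)
  moreover have "xs = map \<pi> [1..int n]"
    by (rule nth_equalityI) (auto simp: len \<pi>_def m_def)
  ultimately show "\<exists>\<pi>\<in>signed_perms n. xs = map \<pi> [1..int n]" by blast
qed

lemma D_descents_inter_01:
  assumes "2 \<le> n"
  shows "D_descents n \<pi> \<inter> {0, 1} = initial_descents (map \<pi> [1..int n])"
  using assms by (auto simp: D_descents_def D_entry_def initial_descents_def nth_map)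

lemma card_D_descents:
  assumes "2 \<le> n"
  shows "card (D_descents n \<pi>) = card (D_descents n \<pi> \<inter> {0, 1}) + des (tl (map \<pi> [1..int n]))"
proof -
  let ?ys = "tl (map \<pi> [1..int n])"
  have nth: "?ys ! j = \<pi> (2 + int j)" if "Suc j < n" for j
    using that by (simp add: nth_tl)
  have "D_descents n \<pi> - {0, 1} = (\<lambda>j. j + 2) ` {j. Suc j < length ?ys \<and> ?ys ! j > ?ys ! Suc j}"
  proof (intro subset_antisym subsetI)
    fix i assume i: "i \<in> D_descents n \<pi> - {0, 1}"
    define j where "j = i - 2"
    have "i = j + 2" using i by (auto simp: j_def)
    then show "i \<in> (\<lambda>j. j + 2) ` {j. Suc j < length ?ys \<and> ?ys ! j > ?ys ! Suc j}"
      using i nth[of j] nth[of "Suc j"]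
      by (auto simp: D_descents_def D_entry_def add_ac intro!: imageI)
  next
    fix i assume "i \<in> (\<lambda>j. j + 2) ` {j. Suc j < length ?ys \<and> ?ys ! j > ?ys ! Suc j}"
    then obtain j where "i = j + 2" "Suc j < n - 1" "?ys ! j > ?ys ! Suc j" by auto
    then show "i \<in> D_descents n \<pi> - {0, 1}"
      using nth[of j] nth[of "Suc j"] by (auto simp: D_descents_def D_entry_def add_ac)
  qed
  then have "card (D_descents n \<pi> - {0, 1}) = des ?ys"
    unfolding des_eq_card by (simp only: card_image[OF inj_onI] add_right_cancel)
  moreover have "finite (D_descents n \<pi>)"
    by (simp add: D_descents_def)
  ultimately show ?thesis
    using card_Int_Diff by metis
qed

text \<open>Pass from \<open>D_n\<close> to \<open>B_n\<close>, then to one-line notation, and split off the initial descents.\<close>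

lemma double_sum_D_perms_eq_tail_des_sum:
  fixes t :: "'a::comm_ring_1"
  assumes n: "2 \<le> n"
  shows "2 * (\<Sum>\<pi> | \<pi> \<in> D_perms n \<and> D_descents n \<pi> \<inter> {0, 1} = S. t ^ card (D_descents n \<pi>))
    = t ^ card S * tail_des_sum t S {1..int n}"
proof -
  let ?h = "\<lambda>X. if X \<inter> {0, 1} = S then t ^ card X else 0"
  let ?w = "\<lambda>xs. if initial_descents xs = S then t ^ card S * t ^ des (tl xs) else 0"
  have "2 * (\<Sum>\<pi> | \<pi> \<in> D_perms n \<and> D_descents n \<pi> \<inter> {0, 1} = S. t ^ card (D_descents n \<pi>))
      = 2 * (\<Sum>\<pi>\<in>D_perms n. ?h (D_descents n \<pi>))"
    by (simp add: sum.inter_filter finite_D_perms)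
  also have "\<dots> = (\<Sum>\<pi>\<in>signed_perms n. ?h (D_descents n \<pi>))"
    using sum_signed_perms_eq_double_sum_D_perms[of n ?h] n by simp
  also have "\<dots> = (\<Sum>\<pi>\<in>signed_perms n. ?w (map \<pi> [1..int n]))"
    by (intro sum.cong) (auto simp: card_D_descents[OF n] power_add simp flip: D_descents_inter_01[OF n])
  also have "\<dots> = (\<Sum>xs\<in>signed_words {1..int n}. ?w xs)"
    by (rule sum.reindex_bij_betw[OF bij_betw_signed_perms_signed_words])
  also have "\<dots> = (\<Sum>xs | xs \<in> signed_words {1..int n} \<and> initial_descents xs = S. t ^ card S * t ^ des (tl xs))"
    by (simp add: sum.inter_filter)
  also have "{xs. xs \<in> signed_words {1..int n} \<and> initial_descents xs = S} = words_with_start S {1..int n}"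
    using n length_signed_word by (auto simp: words_with_start_def)
  finally show ?thesis
    by (simp add: tail_des_sum_def sum_distrib_left)
qed

section \<open>Generating functions\<close>

lemma sorted_tail_words_small: "card A < 2 \<Longrightarrow> sorted_tail_words S A = {}"
  using length_signed_word by (fastforce simp: sorted_tail_words_def words_with_start_def)

lemma tail_des_sum_small: "card A < 2 \<Longrightarrow> tail_des_sum t S A = 0"
proof -
  assume "card A < 2"
  then have "words_with_start S A = {}"
    using length_signed_word by (fastforce simp: words_with_start_def)
  then show ?thesis by (simp add: tail_des_sum_def)
qed

lemma card_sorted_tail_words:
  fixes A :: "int set" and N :: "nat set \<Rightarrow> 'a::comm_ring_1"
  assumes "finite A" "\<And>a. a \<in> A \<Longrightarrow> a > 0"
  defines "N S \<equiv> of_nat (card (sorted_tail_words S A))"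
  shows "N {} = (if card A < 2 then 0 else 2)"
    and "N {0} = (if card A < 2 then 0 else 2 ^ card A - 2)"
    and "N {1} = (if card A < 2 then 0 else 2 ^ card A - 2)"
    and "N {0, 1} = (if card A < 2 then 0 else of_nat (card A) * 2 ^ card A - 2 * 2 ^ card A + 2)"
proof -
  have *: "N {} = 2 \<and> N {0} = 2 ^ card A - 2 \<and> N {1} = 2 ^ card A - 2
     \<and> N {0, 1} = of_nat (card A) * 2 ^ card A - 2 * 2 ^ card A + 2" if "2 \<le> card A"
  proof -
    have "N {} = 2"
      using card_sorted_tail_words_empty[OF assms(1,2) that] by (simp add: N_def)
    moreover have "N {} + N {0} = 2 ^ card A"
      using arg_cong[OF card_sorted_tail_words_empty_plus_0[OF assms(1,2) that], of "of_nat :: nat \<Rightarrow> 'a"]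
      by (simp add: N_def)
    moreover have "N {1} = N {0}"
      unfolding N_def card_sorted_tail_words_1_eq_0 ..
    moreover have "2 ^ card A + (N {1} + N {0, 1}) = of_nat (card A) * 2 ^ card A"
      using arg_cong[OF card_sorted_tail_words_1_plus_01[OF assms(1,2) that], of "of_nat :: nat \<Rightarrow> 'a"]
      by (simp add: N_def)
    ultimately have "N {} = 2" "N {0} = 2 ^ card A - 2" "N {1} = N {0}"
      "N {0, 1} = of_nat (card A) * 2 ^ card A - 2 ^ card A - N {1}"
      by (metis, metis add_diff_cancel_left', metis, metis add_diff_cancel_left' diff_diff_add)
    then show ?thesis by simp
  qed
  show "N {} = (if card A < 2 then 0 else 2)"
    and "N {0} = (if card A < 2 then 0 else 2 ^ card A - 2)"
    and "N {1} = (if card A < 2 then 0 else 2 ^ card A - 2)"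
    and "N {0, 1} = (if card A < 2 then 0 else of_nat (card A) * 2 ^ card A - 2 * 2 ^ card A + 2)"
    using * by (auto simp: N_def sorted_tail_words_small)
qed

lemma sum_Pow_card:
  fixes h :: "nat \<Rightarrow> 'a::comm_semiring_1"
  assumes "finite A"
  shows "(\<Sum>B\<in>Pow A. h (card B)) = (\<Sum>k=0..card A. of_nat (card A choose k) * h k)"
proof -
  have "(\<Sum>B\<in>Pow A. h (card B)) = (\<Sum>k=0..card A. \<Sum>B | B \<in> Pow A \<and> card B = k. h (card B))"
    using assms by (intro sum.group[symmetric]) (auto intro: card_mono)
  also have "\<dots> = (\<Sum>k=0..card A. of_nat (card A choose k) * h k)"
    by (intro sum.cong refl) (simp add: n_subsets[OF assms])
  finally show ?thesis .
qed

text \<open>The coefficients of \<open>G\<close>, scaled by factorials, satisfy the recurrence \<open>tail_des_sum_rec\<close>. By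
  induction only the term \<open>B = A\<close> survives in the difference of the two recurrences, and its
  coefficient \<open>t\<close> is not \<open>1\<close>. In particular the sum depends on \<open>A\<close> only through its size, which
  the recurrence gives without relabelling words.\<close>

lemma tail_des_sum_eq_fps_nth:
  fixes t :: "'a::field_char_0"
  assumes t: "t \<noteq> 1"
    and f: "\<And>A. finite A \<Longrightarrow> (\<And>a. a \<in> A \<Longrightarrow> a > 0) \<Longrightarrow> of_nat (card (sorted_tail_words S A)) = f (card A)"
    and G: "G * (1 - fps_const t * fps_exp (2 * (1 - t))) = Abs_fps (\<lambda>n. (1 - t) ^ (n - 1) * f n / fact n)"
    and "finite A" "\<And>a. a \<in> A \<Longrightarrow> a > 0"
  shows "tail_des_sum t S A = fact (card A) * G $ card A"
proof -
  define g where "g n = fact n * G $ n" for n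
  have g_rec: "g n = (1 - t) ^ (n - 1) * f n
      + t * (\<Sum>k=0..n. of_nat (n choose k) * (g k * (2 * (1 - t)) ^ (n - k)))" for n
  proof -
    have "G = Abs_fps (\<lambda>n. (1 - t) ^ (n - 1) * f n / fact n)
        + fps_const t * (G * fps_exp (2 * (1 - t)))"
      unfolding G[symmetric] by (simp add: algebra_simps)
    then have "G $ n = (Abs_fps (\<lambda>n. (1 - t) ^ (n - 1) * f n / fact n)
        + fps_const t * (G * fps_exp (2 * (1 - t)))) $ n"
      by (rule arg_cong)
    also have "\<dots> = (1 - t) ^ (n - 1) * f n / fact n
        + t * (\<Sum>k=0..n. G $ k * ((2 * (1 - t)) ^ (n - k) / fact (n - k)))"
      by (simp add: fps_mult_nth[of G])
    finally have G_n: "G $ n = (1 - t) ^ (n - 1) * f n / fact n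
        + t * (\<Sum>k=0..n. G $ k * ((2 * (1 - t)) ^ (n - k) / fact (n - k)))" .
    have "g n = fact n * ((1 - t) ^ (n - 1) * f n / fact n)
        + t * (fact n * (\<Sum>k=0..n. G $ k * ((2 * (1 - t)) ^ (n - k) / fact (n - k))))"
      unfolding g_def by (subst G_n) (simp only: distrib_left mult.left_commute)
    then have "g n = (1 - t) ^ (n - 1) * f n
        + t * (\<Sum>k=0..n. fact n * (G $ k * ((2 * (1 - t)) ^ (n - k) / fact (n - k))))"
      by (simp add: sum_distrib_left)
    also have "(\<Sum>k=0..n. fact n * (G $ k * ((2 * (1 - t)) ^ (n - k) / fact (n - k))))
        = (\<Sum>k=0..n. of_nat (n choose k) * (g k * (2 * (1 - t)) ^ (n - k)))"
      by (intro sum.cong refl) (simp add: g_def binomial_fact field_simps)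
    finally show ?thesis .
  qed
  show ?thesis
    using assms(4,5)
  proof (induction A rule: finite_psubset_induct)
    case (psubset A)
    let ?s = "2 * (1 - t)"
    have "tail_des_sum t S A - g (card A)
      = t * ((\<Sum>B\<in>Pow A. tail_des_sum t S B * ?s ^ card (A - B))
           - (\<Sum>k=0..card A. of_nat (card A choose k) * (g k * ?s ^ (card A - k))))"
      using f[OF psubset.hyps psubset.prems] g_rec[of "card A"]
        tail_des_sum_rec[OF psubset.hyps psubset.prems, of t S]
      by (simp add: algebra_simps)
    also have "(\<Sum>k=0..card A. of_nat (card A choose k) * (g k * ?s ^ (card A - k)))
      = (\<Sum>B\<in>Pow A. g (card B) * ?s ^ (card A - card B))"
      by (rule sum_Pow_card[OF psubset.hyps, symmetric])
    also have "\<dots> = (\<Sum>B\<in>Pow A. g (card B) * ?s ^ card (A - B))"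
      using psubset.hyps by (intro sum.cong refl) (auto simp: card_Diff_subset finite_subset)
    also have "(\<Sum>B\<in>Pow A. tail_des_sum t S B * ?s ^ card (A - B)) - \<dots>
      = (\<Sum>B\<in>Pow A. (tail_des_sum t S B - g (card B)) * ?s ^ card (A - B))"
      by (simp add: sum_subtractf left_diff_distrib)
    also have "\<dots> = (\<Sum>B\<in>{A}. (tail_des_sum t S B - g (card B)) * ?s ^ card (A - B))"
    proof (rule sum.mono_neutral_right)
      show "\<forall>B\<in>Pow A - {A}. (tail_des_sum t S B - g (card B)) * ?s ^ card (A - B) = 0"
      proof
        fix B assume "B \<in> Pow A - {A}"
        then have "B \<subset> A" by auto
        then have "tail_des_sum t S B = g (card B)"
          unfolding g_def using psubset.prems by (intro psubset.IH) auto
        then show "(tail_des_sum t S B - g (card B)) * ?s ^ card (A - B) = 0" by simp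
      qed
    qed (use psubset.hyps in auto)
    finally have "(1 - t) * (tail_des_sum t S A - g (card A)) = 0"
      by (simp add: algebra_simps)
    then show ?case
      using t by (simp add: g_def)
  qed
qed

lemma to_fract_power: "to_fract (p ^ k) = to_fract p ^ k"
  by (induction k) simp_all

lemma to_fract_X_neq_1: "to_fract [:0, 1 :: rat:] \<noteq> 1"
proof
  assume "to_fract [:0, 1 :: rat:] = 1"
  then have "[:0, 1 :: rat:] = 1"
    unfolding to_fract_1[symmetric] to_fract_eq_iff .
  then show False by (simp add: one_pCons)
qed

lemma to_fract_sub_eulerian_poly:
  fixes S n
  defines "D \<equiv> {\<pi> \<in> D_perms n. D_descents n \<pi> \<inter> {0, 1} = S}"
  shows "to_fract (sub_eulerian_poly S n) = (\<Sum>\<pi>\<in>D. to_fract [:0, 1:] ^ card (D_descents n \<pi>))"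
proof -
  have "sub_eulerian_poly S n = (\<Sum>k\<le>n. \<Sum>\<pi> | \<pi> \<in> D \<and> card (D_descents n \<pi>) = k. [:0, 1:] ^ card (D_descents n \<pi>))"
    unfolding sub_eulerian_poly_def
  proof (intro sum.cong refl)
    fix k
    have D_k: "{\<pi> \<in> D_perms n. card (D_descents n \<pi>) = k \<and> D_descents n \<pi> \<inter> {0, 1} = S}
        = {\<pi>. \<pi> \<in> D \<and> card (D_descents n \<pi>) = k}"
      by (auto simp: D_def)
    have "(\<Sum>\<pi> | \<pi> \<in> D \<and> card (D_descents n \<pi>) = k. [:0, 1:] ^ card (D_descents n \<pi>))
        = (\<Sum>\<pi> | \<pi> \<in> D \<and> card (D_descents n \<pi>) = k. [:0, 1 :: rat:] ^ k)"
      by (intro sum.cong) auto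
    also have "\<dots> = of_nat (sub_eulerian S n k) * [:0, 1 :: rat:] ^ k"
      unfolding sub_eulerian_def D_k sum_constant ..
    also have "\<dots> = monom (of_nat (sub_eulerian S n k)) k"
      by (simp add: monom_altdef of_nat_poly)
    finally show "monom (of_nat (sub_eulerian S n k)) k
        = (\<Sum>\<pi> | \<pi> \<in> D \<and> card (D_descents n \<pi>) = k. [:0, 1 :: rat:] ^ card (D_descents n \<pi>))" ..
  qed
  also have "\<dots> = (\<Sum>\<pi>\<in>D. [:0, 1:] ^ card (D_descents n \<pi>))"
    using card_D_descents_le by (intro sum.group) (auto simp: D_def finite_D_perms)
  finally show ?thesis
    by (simp add: to_fract_power)
qed

lemma one_minus_fps_const: "1 - fps_const c = fps_const (1 - c :: 'a::ring_1)"
  by (simp flip: fps_const_sub fps_const_1_eq_1)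

text \<open>The common shape of the four generating functions. Multiplying by \<open>1 - t\<close> turns the factor
  \<open>(1 - t)^(n - 1)\<close> of the recurrence into \<open>(1 - t)^n\<close>, so that the right-hand side becomes a series
  in \<open>x (1 - t)\<close>; at \<open>n = 0\<close>, where the exponent is truncated, \<open>f\<close> vanishes.\<close>

lemma sub_eulerian_egf_times_denominator:
  fixes t :: "rat poly fract"
  defines "t \<equiv> to_fract [:0, 1:]"
  assumes f: "\<And>A. finite A \<Longrightarrow> (\<And>a. a \<in> A \<Longrightarrow> a > 0) \<Longrightarrow> of_nat (card (sorted_tail_words S A)) = f (card A)"
  shows "sub_eulerian_egf S * ((1 - fps_const t) * (1 - fps_const t * fps_exp (2 * (1 - t))))
    = fps_const (t ^ card S / 2) * Abs_fps (\<lambda>n. (1 - t) ^ n * f n / fact n)"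
proof -
  have t: "t \<noteq> 1"
    unfolding t_def by (rule to_fract_X_neq_1)
  let ?E = "1 - fps_const t * fps_exp (2 * (1 - t))"
  define F where "F = Abs_fps (\<lambda>n. (1 - t) ^ (n - 1) * f n / fact n)"
  define G where "G = F * inverse ?E"
  have "?E $ 0 \<noteq> 0" using t by simp
  then have GE: "G * ?E = F"
    unfolding G_def by (simp add: mult.assoc inverse_mult_eq_1)
  have G: "tail_des_sum t S {1..int n} = fact n * G $ n" for n
    using tail_des_sum_eq_fps_nth[of t S f G "{1..int n}"] t f GE F_def by auto
  have "sub_eulerian_egf S = fps_const (t ^ card S / 2) * G"
  proof (rule fps_ext)
    fix n
    show "sub_eulerian_egf S $ n = (fps_const (t ^ card S / 2) * G) $ n"
    proof (cases "2 \<le> n")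
      case True
      have "2 * to_fract (sub_eulerian_poly S n) = t ^ card S * (fact n * G $ n)"
        using double_sum_D_perms_eq_tail_des_sum[OF True, where t = t and S = S]
        unfolding to_fract_sub_eulerian_poly t_def[symmetric] G by simp
      then show ?thesis
        using True by (simp add: sub_eulerian_egf_def field_simps)
    next
      case False
      then have "fact n * G $ n = 0"
        using tail_des_sum_small[where A = "{1..int n}" and t = t and S = S] G[of n] by simp
      then show ?thesis using False by (simp add: sub_eulerian_egf_def)
    qed
  qed
  then have "sub_eulerian_egf S * ((1 - fps_const t) * ?E) = fps_const (t ^ card S / 2) * ((1 - fps_const t) * F)"
    by (simp only: GE[symmetric] mult_ac)
  also have "(1 - fps_const t) * F = Abs_fps (\<lambda>n. (1 - t) ^ n * f n / fact n)"
  proof (rule fps_ext)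
    fix n
    have "f 0 = 0"
      using f[of "{}"] sorted_tail_words_small[of "{}" S] by simp
    then show "((1 - fps_const t) * F) $ n = Abs_fps (\<lambda>n. (1 - t) ^ n * f n / fact n) $ n"
      unfolding one_minus_fps_const by (cases n) (simp_all add: F_def mult.assoc del: fact_Suc)
  qed
  finally show ?thesis .
qed

text \<open>The counts of words with increasing tail, as series in \<open>x (1 - t)\<close>.\<close>

lemma numerator_egfs:
  fixes t :: "'a::field_char_0"
  defines "T \<equiv> fps_const t" and "egf \<equiv> \<lambda>f. Abs_fps (\<lambda>n. (1 - t) ^ n * f n / fact n)"
  shows "egf (\<lambda>n. if n < 2 then 0 else 2) = 2 * (- 1 - fps_X * (1 - T) + fps_exp (1 - t))"
    and "egf (\<lambda>n. if n < 2 then 0 else 2 ^ n - 2) = (fps_exp (1 - t) - 1)\<^sup>2"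
    and "egf (\<lambda>n. if n < 2 then 0 else of_nat n * 2 ^ n - 2 * 2 ^ n + 2)
      = 2 * (fps_exp (1 - t) - (1 - fps_X * (1 - T)) * fps_exp (2 * (1 - t)))"
proof -
  have T: "1 - T = fps_const (1 - t)"
    unfolding T_def by (rule one_minus_fps_const)
  have nat_cases: "\<And>n::nat. n = 0 \<or> n = 1 \<or> (\<exists>m. n = Suc (Suc m))"
    by presburger
  have two: "(2 :: 'a fps) = fps_const 2"
    by (simp add: numeral_fps_const)
  show "egf (\<lambda>n. if n < 2 then 0 else 2) = 2 * (- 1 - fps_X * (1 - T) + fps_exp (1 - t))"
  proof (rule fps_ext)
    fix n
    show "egf (\<lambda>n. if n < 2 then 0 else 2) $ n = (2 * (- 1 - fps_X * (1 - T) + fps_exp (1 - t))) $ n"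
      using nat_cases[of n] unfolding T two egf_def
      by (auto simp del: fact_Suc)
  qed
  have "(fps_exp (1 - t) - 1)\<^sup>2 = fps_exp (2 * (1 - t)) - 2 * fps_exp (1 - t) + 1"
    using fps_exp_add_mult[of "1 - t" "1 - t"] by (simp add: power2_eq_square algebra_simps)
  moreover have "egf (\<lambda>n. if n < 2 then 0 else 2 ^ n - 2) = \<dots>"
  proof (rule fps_ext)
    fix n
    show "egf (\<lambda>n. if n < 2 then 0 else 2 ^ n - 2) $ n = (fps_exp (2 * (1 - t)) - 2 * fps_exp (1 - t) + 1) $ n"
    proof -
      have "(fps_exp (2 * (1 - t)) - 2 * fps_exp (1 - t) + 1) $ n
          = (2 * (1 - t)) ^ n / fact n - 2 * ((1 - t) ^ n / fact n) + of_bool (n = 0)"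
        unfolding two by simp
      also have "\<dots> = (1 - t) ^ n * (2 ^ n - 2) / fact n + of_bool (n = 0)"
        unfolding power_mult_distrib by (simp only: right_diff_distrib diff_divide_distrib times_divide_eq_right mult.commute)
      finally show ?thesis
        using nat_cases[of n] by (auto simp: egf_def simp del: fact_Suc power_Suc)
    qed
  qed
  ultimately show "egf (\<lambda>n. if n < 2 then 0 else 2 ^ n - 2) = (fps_exp (1 - t) - 1)\<^sup>2"
    by simp
  show "egf (\<lambda>n. if n < 2 then 0 else of_nat n * 2 ^ n - 2 * 2 ^ n + 2)
      = 2 * (fps_exp (1 - t) - (1 - fps_X * (1 - T)) * fps_exp (2 * (1 - t)))"
  proof (rule fps_ext)
    fix n
    have eq: "2 * (fps_exp (1 - t) - (1 - fps_X * (1 - T)) * fps_exp (2 * (1 - t)))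
      = fps_const 2 * (fps_exp (1 - t) - fps_exp (2 * (1 - t)) + fps_const (1 - t) * (fps_X * fps_exp (2 * (1 - t))))"
      unfolding T two by (simp add: algebra_simps)
    show "egf (\<lambda>n. if n < 2 then 0 else of_nat n * 2 ^ n - 2 * 2 ^ n + 2) $ n
      = (2 * (fps_exp (1 - t) - (1 - fps_X * (1 - T)) * fps_exp (2 * (1 - t)))) $ n"
      unfolding eq egf_def
    proof (cases n)
      case (Suc m)
      have "(2 * (1 - t)) ^ m / fact m = of_nat n * (2 * (1 - t)) ^ m / fact n"
        unfolding Suc fact_Suc by (rule nonzero_mult_divide_mult_cancel_left[symmetric]) (rule of_nat_neq_0)
      then have "(1 - t) * ((2 * (1 - t)) ^ m / fact m) * 2 = (2 * (1 - t)) ^ n * of_nat n / fact n"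
        unfolding Suc power_Suc by (simp only: times_divide_eq_left times_divide_eq_right mult_ac)
      also have "\<dots> = (1 - t) ^ n * (of_nat n * 2 ^ n) / fact n"
        unfolding power_mult_distrib by (simp only: mult_ac)
      finally have X: "(1 - t) * ((2 * (1 - t)) ^ m / fact m) * 2 = (1 - t) ^ n * (of_nat n * 2 ^ n) / fact n" .
      have lin: "2 * (a - b + c) = 2 * a - 2 * b + c * 2" for a b c :: 'a
        by (simp add: algebra_simps)
      have comb: "2 * (a / d) - 2 * (b * a / d) + a * (c * b) / d = a * (c * b - 2 * b + 2) / d" for a b c d :: 'a
        by (simp add: algebra_simps diff_divide_distrib add_divide_distrib)
      have "(fps_const 2 * (fps_exp (1 - t) - fps_exp (2 * (1 - t)) + fps_const (1 - t) * (fps_X * fps_exp (2 * (1 - t))))) $ n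
        = 2 * ((1 - t) ^ n / fact n - (2 * (1 - t)) ^ n / fact n + (1 - t) * ((2 * (1 - t)) ^ m / fact m))"
        by (simp add: Suc del: fact_Suc power_Suc)
      also have "\<dots> = (1 - t) ^ n * (of_nat n * 2 ^ n - 2 * 2 ^ n + 2) / fact n"
        unfolding lin X unfolding power_mult_distrib by (rule comb)
      finally have "(fps_const 2 * (fps_exp (1 - t) - fps_exp (2 * (1 - t)) + fps_const (1 - t) * (fps_X * fps_exp (2 * (1 - t))))) $ n
        = (1 - t) ^ n * (of_nat n * 2 ^ n - 2 * 2 ^ n + 2) / fact n" .
      then show "Abs_fps (\<lambda>n. (1 - t) ^ n * (if n < 2 then 0 else of_nat n * 2 ^ n - 2 * 2 ^ n + 2) / fact n) $ n
        = (fps_const 2 * (fps_exp (1 - t) - fps_exp (2 * (1 - t)) + fps_const (1 - t) * (fps_X * fps_exp (2 * (1 - t))))) $ n"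
        by (cases "n < 2") (auto simp: Suc)
    qed simp
  qed
qed

theorem theorem4p2:
  fixes t :: "rat poly fract" and T :: "rat poly fract fps"
  defines "t \<equiv> to_fract [:0, 1:]" and "T \<equiv> fps_const t"
  shows
    "(sub_eulerian_egf {0} =
        T * (fps_exp (1 - t) - 1)\<^sup>2 / (2 * (1 - T) * (1 - T * fps_exp (2 * (1 - t)))) \<and>
      T * (fps_exp (1 - t) - 1)\<^sup>2 / (2 * (1 - T) * (1 - T * fps_exp (2 * (1 - t)))) =
        sub_eulerian_egf {1}) \<and>
     sub_eulerian_egf {} =
        (- 1 - fps_X * (1 - T) + fps_exp (1 - t)) / ((1 - T) * (1 - T * fps_exp (2 * (1 - t)))) \<and>
     sub_eulerian_egf {0, 1} =
        (T\<^sup>2 * fps_exp (1 - t) - T\<^sup>2 * (1 - fps_X * (1 - T)) * fps_exp (2 * (1 - t))) /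
        ((1 - T) * (1 - T * fps_exp (2 * (1 - t))))"
proof -
  let ?D = "(1 - T) * (1 - T * fps_exp (2 * (1 - t)))"
  have "t \<noteq> 1"
    unfolding t_def by (rule to_fract_X_neq_1)
  then have "?D $ 0 \<noteq> 0" by (simp add: T_def)
  then have D: "?D \<noteq> 0" by (rule contrapos_nn) (simp only: fps_zero_nth)
  have half: "2 * fps_const (c / 2) = fps_const c" for c :: "rat poly fract"
    by (simp add: numeral_fps_const)
  note egf = sub_eulerian_egf_times_denominator[folded t_def, folded T_def]
  have S: "2 * ?D * sub_eulerian_egf S = T * (fps_exp (1 - t) - 1)\<^sup>2" if "S = {0} \<or> S = {1}" for S
  proof -
    have "sub_eulerian_egf S * ?D = fps_const (t / 2) * (fps_exp (1 - t) - 1)\<^sup>2"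
      using that egf[OF card_sorted_tail_words(2)] egf[OF card_sorted_tail_words(3)]
      by (auto simp: numerator_egfs(2))
    then have "2 * (sub_eulerian_egf S * ?D) = 2 * (fps_const (t / 2) * (fps_exp (1 - t) - 1)\<^sup>2)"
      by (rule arg_cong)
    then have "2 * ?D * sub_eulerian_egf S = (2 * fps_const (t / 2)) * (fps_exp (1 - t) - 1)\<^sup>2"
      by (simp only: mult_ac)
    then show ?thesis by (simp only: half T_def)
  qed
  have E: "?D * sub_eulerian_egf {} = - 1 - fps_X * (1 - T) + fps_exp (1 - t)"
  proof -
    have "sub_eulerian_egf {} * ?D = fps_const (1 / 2) * (2 * (- 1 - fps_X * (1 - T) + fps_exp (1 - t)))"
      using egf[OF card_sorted_tail_words(1)] unfolding numerator_egfs(1) T_def by simp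
    also have "\<dots> = (2 * fps_const (1 / 2)) * (- 1 - fps_X * (1 - T) + fps_exp (1 - t))"
      by (simp only: mult_ac)
    finally show ?thesis by (simp only: half fps_const_1_eq_1 mult_1_left mult.commute)
  qed
  have Z: "?D * sub_eulerian_egf {0, 1}
    = T\<^sup>2 * fps_exp (1 - t) - T\<^sup>2 * (1 - fps_X * (1 - T)) * fps_exp (2 * (1 - t))"
  proof -
    have "sub_eulerian_egf {0, 1} * ?D = fps_const (t\<^sup>2 / 2)
       * (2 * (fps_exp (1 - t) - (1 - fps_X * (1 - T)) * fps_exp (2 * (1 - t))))"
      using egf[OF card_sorted_tail_words(4)] unfolding numerator_egfs(3) T_def
      by (simp add: numeral_2_eq_2)
    also have "\<dots> = (2 * fps_const (t\<^sup>2 / 2)) * (fps_exp (1 - t) - (1 - fps_X * (1 - T)) * fps_exp (2 * (1 - t)))"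
      by (simp only: mult_ac)
    also have "2 * fps_const (t\<^sup>2 / 2) = T\<^sup>2"
      unfolding half T_def by (rule fps_const_power[symmetric])
    finally show ?thesis by (simp add: algebra_simps)
  qed
  have div: "a = b / d" if "d * a = b" "d \<noteq> 0" for a b d :: "rat poly fract fps"
    using that by (metis nonzero_mult_div_cancel_left)
  have D2: "2 * (1 - T) * (1 - T * fps_exp (2 * (1 - t))) = 2 * ?D"
    by (rule mult.assoc)
  have "2 * ?D \<noteq> 0" using D by simp
  then show ?thesis
    unfolding D2 using div[OF S] div[OF E D] div[OF Z D] by auto
qed

end
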